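(* Let $r,s,t$ be integers with $0\le r\le s<t$ and $\gcd(r,s,t)=1$, and let $(i,j,k)\in\mathbb Z^3$ with $i+j+k$ even and $ri+sj+tk\ge 0$. Let $\mathcal G=\mathcal G_{i,j,k}^{r,s,t}$ be the dimer graph of the solution $T_{i,j,k}$ of the $T$-system with $(r,s,t)$-slanted initial data. Define $$(\tilde i,\tilde j,\tilde k,\tilde l,\tilde m,\tilde n)=\begin{cases}\bigl(t+s,\;t-s,\;t+r,\;t-r,\;2t,\;ri+sj+tk+2t\bigr) & \text{if } r,s,t \text{ are not all odd},\\[4pt] \bigl(\tfrac{t+s}{2},\;\tfrac{t-s}{2},\;\tfrac{t+r}{2},\;\tfrac{t-r}{2},\;t,\;\tfrac{ri+sj+tk}{2}+t\bigr)& \text{if } r,s,t \text{ are all odd}.\end{cases}$$ Then $\mathcal G$ is identified (up to a flip of the plane exchanging horizontal and vertical directions) with the pinecone $\mathcal P(\tilde n;\tilde i,\tilde j,\tilde k,\tilde l)$, the strip $x$ of $\mathcal G$ being identified with the lower row $R=x-i$ of the pinecone if $x\ge i$ and with the upper row $R=i-x$ if $x\le i$. That is, for every $x\in\mathbb Z$ the set of positions of the extra central edges in the strip $x$ of $\mathcal G$ equals the set of positions of the extra central edges in the corresponding row of $\mathcal P(\tilde n;\tilde i,\tilde j,\tilde k,\tilde l)$.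
   Context: The $T$-system is $T_{i,j,k+1}T_{i,j,k-1}=T_{i+1,j,k}T_{i-1,j,k}+T_{i,j+1,k}T_{i,j-1,k}$ on points of $\mathbb Z^3$ with $i+j+k$ even. The $(r,s,t)$-slanted initial data prescribe $T$ on the stepped surface of points $(x,y,k_{x,y})$, $k_{x,y}=x+y-2\left\lfloor\frac{rx+sy+t(x+y)}{2t}\right\rfloor$. The solution $T_{i,j,k}$ is a partition function of dimers on the bipartite graph $\mathcal G$ dual to the tessellation of the part of this stepped surface lying in the cone $|x-i|+|y-j|\le|z-k|$. Description of $\mathcal G$. The graph $\mathcal G$ is organized into parallel strips of width 1 indexed by $x\in\mathbb Z$. Each strip is a succession of hexagons of a brick-wall lattice, some of which are cut into two squares by an extra central edge. $\mathcal G$ is determined by the positions (coordinates along the strip) of these extra edges: in the strip $x$ they are the numbers $$w(x,u)=k-j+1-x+2\left\lfloor\frac{(t+s)u+(r-s)x}{t-s}\right\rfloor ,\qquad u\in\mathbb Z,$$ that satisfy $w_{\min}(x)\le w(x,u)\le w_{\max}(x)$, where $$w_{\min}(x)=1-(x-i),\quad w_{\max}(x)=1+\frac{2(ri+sj+tk)+(2r+t+s)(x-i)}{t-s}\qquad\Bigl(-\tfrac{ri+sj+tk}{t+r}\le x-i\le 0\Bigr),$$ $$w_{\min}(x)=1+(x-i),\quad w_{\max}(x)=1+\frac{2(ri+sj+tk)+(2r-t-s)(x-i)}{t-s}\qquad\Bigl(0\le x-i\le\tfrac{ri+sj+tk}{t-r}\Bigr),$$ and there are no such edges for other values of $x$.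 Pinecones (Bousquet-Mélou, Propp, West). Let $\tilde i,\tilde j,\tilde k,\tilde l,\tilde m$ be positive integers with $\tilde i+\tilde j=\tilde k+\tilde l=\tilde m$ and $\tilde j=\min\{\tilde i,\tilde j,\tilde k,\tilde l\}$. For integers $\tilde n,R,C$ put $$U(\tilde n,R,C)=2C+R-3-2\left\lfloor\frac{\tilde mC+\tilde kR+\tilde i-\tilde n-1}{\tilde j}\right\rfloor,\qquad L(\tilde n,R,C)=2C+R-3-2\left\lfloor\frac{\tilde mC+\tilde lR+\tilde i-\tilde n-1}{\tilde j}\right\rfloor .$$ The pinecone $\mathcal P(\tilde n;\tilde i,\tilde j,\tilde k,\tilde l)$ is drawn on the brick-wall lattice made of horizontal hexagons, arranged in rows; some hexagons are cut into two squares by an extra central vertical edge, and the pinecone is determined by the (horizontal) positions of these extra edges: in the upper row $R=0,1,2,\dots$ they are the numbers $U(\tilde n,R,C)$ with $C\in\mathbb Z_{\ge0}$ and $U(\tilde n,R,C)>R$; in the lower row $R=0,1,2,\dots$ they are the numbers $L(\tilde n,R,C)$ with $C\in\mathbb Z_{\ge 0}$ and $L(\tilde n,R,C)>R$ (upper row $0$ and lower row $0$ are the same row). *)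

theory Defs
  imports Complex_Main
begin

text \<open>
  Both graphs live on a brick-wall lattice decomposed into parallel strips (rows) of hexagons and
  are determined by the integer positions, along each strip, of the extra central edges that cut a
  hexagon into two squares. They are therefore encoded by these sets of positions.
\<close>

section \<open>The dimer graph of the T-system with slanted initial data\<close>

definition slanted_level :: "int \<Rightarrow> int \<Rightarrow> int \<Rightarrow> int \<Rightarrow> int \<Rightarrow> int \<Rightarrow> int" where
  "slanted_level r s t i j k = r * i + s * j + t * k"

definition strip_w ::
    "int \<Rightarrow> int \<Rightarrow> int \<Rightarrow> int \<Rightarrow> int \<Rightarrow> int \<Rightarrow> int \<Rightarrow> int" where
  "strip_w r s t j k x u =
     k - j + 1 - x
     + 2 * \<lfloor>real_of_int ((t + s) * u + (r - s) * x) / real_of_int (t - s)\<rfloor>"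

text \<open>The two clauses overlap at \<open>x = i\<close>, where their bounds agree. Strips satisfying neither
  range condition on \<open>x - i\<close> carry no extra edges.\<close>

definition strip_positions ::
    "int \<Rightarrow> int \<Rightarrow> int \<Rightarrow> int \<Rightarrow> int \<Rightarrow> int \<Rightarrow> int \<Rightarrow> int set" where
  "strip_positions r s t i j k x =
     (let N = real_of_int (slanted_level r s t i j k);
          d = real_of_int (x - i)
      in if - (N / real_of_int (t + r)) \<le> d \<and> d \<le> 0 then
           {w. (\<exists>u. w = strip_w r s t j k x u)
             \<and> 1 - d \<le> real_of_int w
             \<and> real_of_int w \<le> 1 + (2 * N + real_of_int (2 * r + t + s) * d) / real_of_int (t - s)}
         else if 0 \<le> d \<and> d \<le> N / real_of_int (t - r) then
           {w. (\<exists>u. w = strip_w r s t j k x u)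
             \<and> 1 + d \<le> real_of_int w
             \<and> real_of_int w \<le> 1 + (2 * N + real_of_int (2 * r - t - s) * d) / real_of_int (t - s)}
         else {})"

section \<open>Pinecones\<close>

definition pinecone_parameters :: "int \<Rightarrow> int \<Rightarrow> int \<Rightarrow> int \<Rightarrow> int \<Rightarrow> bool" where
  "pinecone_parameters i j k l m \<longleftrightarrow>
     0 < i \<and> 0 < j \<and> 0 < k \<and> 0 < l \<and> 0 < m \<and>
     i + j = m \<and> k + l = m \<and> j = Min {i, j, k, l}"

text \<open>The arguments \<open>n i j k l\<close> are those of the pinecone \<open>P(n; i, j, k, l)\<close>; the
  parameter \<open>m\<close> is recovered as \<open>i + j\<close>.\<close>

definition pinecone_U ::
    "int \<Rightarrow> int \<Rightarrow> int \<Rightarrow> int \<Rightarrow> int \<Rightarrow> int \<Rightarrow> int \<Rightarrow> int" where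
  "pinecone_U n i j k l R C =
     2 * C + R - 3
     - 2 * \<lfloor>real_of_int ((i + j) * C + k * R + i - n - 1) / real_of_int j\<rfloor>"

definition pinecone_L ::
    "int \<Rightarrow> int \<Rightarrow> int \<Rightarrow> int \<Rightarrow> int \<Rightarrow> int \<Rightarrow> int \<Rightarrow> int" where
  "pinecone_L n i j k l R C =
     2 * C + R - 3
     - 2 * \<lfloor>real_of_int ((i + j) * C + l * R + i - n - 1) / real_of_int j\<rfloor>"

text \<open>Rows are indexed by \<open>R \<ge> 0\<close>; upper row \<open>0\<close> and lower row \<open>0\<close> are the same row.\<close>

definition pinecone_upper_row ::
    "int \<Rightarrow> int \<Rightarrow> int \<Rightarrow> int \<Rightarrow> int \<Rightarrow> int \<Rightarrow> int set" where
  "pinecone_upper_row n i j k l R =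
     {pinecone_U n i j k l R C | C. 0 \<le> C \<and> pinecone_U n i j k l R C > R}"

definition pinecone_lower_row ::
    "int \<Rightarrow> int \<Rightarrow> int \<Rightarrow> int \<Rightarrow> int \<Rightarrow> int \<Rightarrow> int set" where
  "pinecone_lower_row n i j k l R =
     {pinecone_L n i j k l R C | C. 0 \<le> C \<and> pinecone_L n i j k l R C > R}"

end

(* Write N = ri + sj + tk. Since -floor((X - 1) / j') = floor(-X / j') + 1 for integers X, the extra
   edges of the pinecone sit at R + 1 + 2 floor((Y - i' C) / j'), where Y is N - (t + r) R (upper row)
   or N - (t - r) R (lower row), halved in the all-odd case. An affine change of index u <-> C turns
   w(x,u) into the same expression. As i' >= j', the upper bound w_max is the condition C >= 0. The
   range of x is the condition Y >= 0, without which no C >= 0 gives a position beyond R. *)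
theory Submission
  imports Defs
begin

section \<open>Positions in a pinecone row as integer quotients\<close>

lemma minus_div_pred:
  fixes a d :: int
  assumes "0 < d"
  shows "(- a) div d = - ((a - 1) div d) - 1"
proof (rule int_div_pos_eq)
  \<comment> \<open>If \<open>a - 1\<close> leaves remainder \<rho> modulo \<open>d\<close>, then
    \<open>- a\<close> leaves the complementary remainder \<open>d - 1 -\<close> \<rho>.\<close>
  show "- a = d * (- ((a - 1) div d) - 1) + (d - 1 - (a - 1) mod d)"
    using mult_div_mod_eq[of d "a - 1"] by (simp add: algebra_simps)
  show "0 \<le> d - 1 - (a - 1) mod d" and "d - 1 - (a - 1) mod d < d"
    using pos_mod_bound[OF assms, of "a - 1"] pos_mod_sign[OF assms, of "a - 1"] by linarith+
qed

text \<open>Reflection of the pinecone: exchanging \<open>k\<close> and \<open>l\<close> swaps upper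
  and lower rows, so row computations are done for upper rows only.\<close>

lemma pinecone_L_eq_U: "pinecone_L n i j k l R C = pinecone_U n i j l k R C"
  by (simp add: pinecone_L_def pinecone_U_def)

lemma pinecone_lower_row_eq_upper_row:
  "pinecone_lower_row n i j k l R = pinecone_upper_row n i j l k R"
  by (simp add: pinecone_lower_row_def pinecone_upper_row_def pinecone_L_eq_U)

lemma pinecone_U_eq:
  assumes "0 < j"
  shows "pinecone_U n i j k l R C = R + 1 + 2 * ((n - (i + j) - k * R - i * C) div j)"
proof -
  define X where "X = i * C + k * R - (n - (i + j))"
  \<comment> \<open>The multiple \<open>(C - 1) * j\<close> leaves the quotient and cancels the
    \<open>2 * C\<close> of \<open>pinecone_U\<close>; the constant -3 becomes -1, and then +1 by
    \<open>minus_div_pred\<close>.\<close>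
  have "(i + j) * C + k * R + i - n - 1 = (X - 1) + (C - 1) * j"
    by (simp add: X_def algebra_simps)
  then have "((i + j) * C + k * R + i - n - 1) div j = C - 1 + (X - 1) div j"
    using assms by (simp only: div_mult_self1)
  moreover have "n - (i + j) - k * R - i * C = - X"
    by (simp add: X_def)
  ultimately show ?thesis
    using minus_div_pred[OF assms, of X]
    unfolding pinecone_U_def floor_divide_of_int_eq by simp
qed

lemma index_bounds_iff:
  fixes i j Y R C w :: int
  assumes "0 < j" and "j \<le> i" and w: "w = R + 1 + 2 * ((Y - i * C) div j)"
  shows "0 \<le> C \<and> R < w \<longleftrightarrow>
    0 \<le> Y \<and> 1 + R \<le> w \<and> real_of_int w \<le> 1 + R + 2 * (real_of_int Y / real_of_int j)"
proof -
  have "real_of_int w \<le> 1 + R + 2 * (real_of_int Y / real_of_int j) \<longleftrightarrow>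
      real_of_int ((Y - i * C) div j) \<le> real_of_int Y / real_of_int j"
    unfolding w by simp linarith
  also have "\<dots> \<longleftrightarrow> (Y - i * C) div j \<le> Y div j"
    by (simp flip: le_floor_iff add: floor_divide_of_int_eq)
  also have "\<dots> \<longleftrightarrow> 0 \<le> C"
  proof
    assume "0 \<le> C"
    then have "0 \<le> i * C" using assms by simp
    then show "(Y - i * C) div j \<le> Y div j"
      using assms by (intro zdiv_mono1) auto
  next
    assume le: "(Y - i * C) div j \<le> Y div j"
    show "0 \<le> C"
    proof (rule ccontr)
      assume "\<not> 0 \<le> C"
      then have "i * 1 \<le> i * (- C)"
        using assms by (intro mult_left_mono) auto
      \<comment> \<open>For \<open>C \<le> -1\<close> the numerator exceeds \<open>Y\<close> by at
        least \<open>i \<ge> j\<close>, so the quotient is at least \<open>Y div j + 1\<close>, past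
        the upper bound.\<close>
      then have "(Y + j) div j \<le> (Y - i * C) div j"
        using assms by (intro zdiv_mono1) auto
      with le assms show False by simp
    qed
  qed
  finally have *: "real_of_int w \<le> 1 + R + 2 * (real_of_int Y / real_of_int j) \<longleftrightarrow> 0 \<le> C" .
  \<comment> \<open>A position beyond \<open>R\<close> has a nonnegative quotient, which forces
    \<open>Y \<ge> i * C \<ge> 0\<close>.\<close>
  have "0 \<le> Y" if "0 \<le> C" "R < w"
  proof -
    have "0 \<le> (Y - i * C) div j" using that w by simp
    then have "0 \<le> Y - i * C" using assms by (simp add: pos_imp_zdiv_nonneg_iff)
    moreover have "0 \<le> i * C" using that assms by simp
    ultimately show ?thesis by simp
  qed
  with * show ?thesis by auto
qed

lemma pinecone_upper_row_eq:
  fixes i j k l n R Y :: int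
  assumes "0 < j" and "j \<le> i" and Y: "Y = n - (i + j) - k * R"
  shows "pinecone_upper_row n i j k l R =
    {w. 0 \<le> Y \<and> (\<exists>C. w = R + 1 + 2 * ((Y - i * C) div j)) \<and> 1 + R \<le> w \<and>
        real_of_int w \<le> 1 + R + 2 * (real_of_int Y / real_of_int j)}"
proof -
  have "pinecone_upper_row n i j k l R =
      {w. \<exists>C. w = R + 1 + 2 * ((Y - i * C) div j) \<and> (0 \<le> C \<and> R < w)}"
    unfolding pinecone_upper_row_def pinecone_U_eq[OF assms(1)] Y[symmetric]
    by (intro Collect_cong ex_cong1 conj_cong refl) simp
  also have "\<dots> = {w. \<exists>C. w = R + 1 + 2 * ((Y - i * C) div j) \<and>
      (0 \<le> Y \<and> 1 + R \<le> w \<and> real_of_int w \<le> 1 + R + 2 * (real_of_int Y / real_of_int j))}"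
    by (rule Collect_cong, rule ex_cong1, rule conj_cong[OF refl index_bounds_iff[OF assms(1,2)]])
  finally show ?thesis by (simp only: ex_simps simp_thms conj_ac)
qed

section \<open>Strips of the dimer graph in pinecone coordinates\<close>

text \<open>The factor \<open>c\<close> (1 or 2) treats both parity cases at once, and
  \<open>M\<close> is the level divided by \<open>c\<close>. The affine change of index is
  \<open>C = (i + j + k) / 2 - u - (i - x)\<close>, integral because \<open>i + j + k\<close> is
  even.\<close>

lemma strip_w_scaled:
  fixes c :: int
  assumes "0 < c" and "t + s = c * i'" and "t - s = c * j'" and "t + r = c * k'"
    and "slanted_level r s t i j k = c * M" and "even (i + j + k)" and "0 < j'"
  shows "strip_w r s t j k x u =
    i - x + 1 + 2 * ((M - k' * (i - x) - i' * ((i + j + k) div 2 - u - (i - x))) div j')"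
proof -
  obtain h where h: "i + j + k = 2 * h" using assms(6) by (rule evenE)
  have num: "(t + s) * u + (r - s) * x = c * (i' * u + (k' - i') * x)"
  proof -
    have "r - s = c * (k' - i')"
      using assms(2,4) by (simp add: algebra_simps)
    then show ?thesis
      unfolding assms(2) by (simp only:) (simp add: algebra_simps)
  qed
  have w: "strip_w r s t j k x u = k - j + 1 - x + 2 * ((i' * u + (k' - i') * x) div j')"
    unfolding strip_w_def floor_divide_of_int_eq num assms(3) using assms(1) by simp
  \<comment> \<open>This is \<open>r * i + s * j + t * k = (t + r) * i + (t + s) * j + 2 * t * (h -
    i - j)\<close>, since \<open>2 * (h - i - j) = k - i - j\<close>.\<close>
  have "c * M = c * (k' * i + i' * j + (i' + j') * (h - i - j))"
  proof -
    have k: "k = 2 * h - i - j" using h by simp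
    have "c * (k' * i + i' * j + (i' + j') * (h - i - j)) =
        (c * k') * i + (c * i') * j + (c * i' + c * j') * (h - i - j)"
      by (simp add: algebra_simps)
    also have "\<dots> = (t + r) * i + (t + s) * j + (t + s + (t - s)) * (h - i - j)"
      using assms(2-4) by metis
    also have "\<dots> = slanted_level r s t i j k"
      unfolding slanted_level_def k by (simp add: algebra_simps)
    finally show ?thesis unfolding assms(5) by (rule sym)
  qed
  then have M: "M = k' * i + i' * j + (i' + j') * (h - i - j)"
    using assms(1) by simp
  \<comment> \<open>The two numerators differ by a multiple of \<open>j'\<close>; its doubled
    quotient \<open>k - i - j\<close> accounts for the change of offset from
    \<open>i - x + 1\<close> to \<open>k - j + 1 - x\<close>.\<close>
  have "M - k' * (i - x) - i' * (h - u - (i - x)) =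
      (i' * u + (k' - i') * x) + (h - i - j) * j'"
    unfolding M by (simp add: algebra_simps)
  then have "(M - k' * (i - x) - i' * (h - u - (i - x))) div j' =
      h - i - j + (i' * u + (k' - i') * x) div j'"
    using assms(7) by simp
  with w h show ?thesis by simp
qed

lemma strip_positions_eq_upper_row:
  fixes c :: int
  assumes c: "0 < c" "t + s = c * i'" "t - s = c * j'" "t + r = c * k'"
    and M: "slanted_level r s t i j k = c * M" and even: "even (i + j + k)"
    and pos: "0 < j'" "j' \<le> i'" "0 < k'" "0 \<le> M" and "x \<le> i"
  shows "strip_positions r s t i j k x = pinecone_upper_row (M + i' + j') i' j' k' l' (i - x)"
proof -
  define R where "R = i - x"
  define Y where "Y = M - k' * R"
  have R: "0 \<le> R" "x = i - R" using assms by (auto simp: R_def)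
  have ex: "(\<exists>u. w = strip_w r s t j k x u) \<longleftrightarrow>
      (\<exists>C. w = R + 1 + 2 * ((Y - i' * C) div j'))" for w
  proof -
    have w: "strip_w r s t j k x u =
        R + 1 + 2 * ((Y - i' * ((i + j + k) div 2 - u - R)) div j')" for u
      using strip_w_scaled[OF c M even pos(1)] by (simp add: R_def Y_def)
    have "\<exists>u. C = (i + j + k) div 2 - u - R" for C
      by (rule exI[of _ "(i + j + k) div 2 - C - R"]) simp
    then show ?thesis unfolding w by metis
  qed
  have "- (real_of_int (c * M) / real_of_int (c * k')) \<le> real_of_int (x - i) \<longleftrightarrow>
      real_of_int R \<le> real_of_int M / real_of_int k'"
    using c(1) by (simp add: R_def) linarith
  also have "\<dots> \<longleftrightarrow> real_of_int (k' * R) \<le> real_of_int M"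
    using pos by (simp add: pos_le_divide_eq mult.commute)
  also have "\<dots> \<longleftrightarrow> 0 \<le> Y"
    unfolding of_int_le_iff Y_def by simp
  finally have range: "- (real_of_int (c * M) / real_of_int (c * k')) \<le> real_of_int (x - i) \<longleftrightarrow> 0 \<le> Y" .
  \<comment> \<open>From \<open>2 * r + t + s = 2 * (t + r) - (t - s)\<close>; with
    \<open>x - i = - R\<close> this turns \<open>w_max\<close> into
    \<open>1 + R + 2 * Y / j'\<close>.\<close>
  have sum: "2 * r + t + s = c * (2 * k' - j')"
    using c by (simp add: algebra_simps)
  have "2 * real_of_int (c * M) + real_of_int (c * (2 * k' - j')) * real_of_int (x - i) =
      real_of_int c * (2 * real_of_int Y + R * real_of_int j')"
    by (simp add: R_def Y_def algebra_simps)
  then have wmax: "1 + (2 * real_of_int (c * M) + real_of_int (c * (2 * k' - j')) * real_of_int (x - i))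
      / real_of_int (c * j') = 1 + R + 2 * (real_of_int Y / real_of_int j')"
    using c(1) pos by (simp add: field_simps)
  have wmin: "1 - real_of_int (x - i) \<le> real_of_int w \<longleftrightarrow> 1 + R \<le> w" for w
    by (simp add: R_def) linarith
  have row: "pinecone_upper_row (M + i' + j') i' j' k' l' R =
    {w. 0 \<le> Y \<and> (\<exists>C. w = R + 1 + 2 * ((Y - i' * C) div j')) \<and> 1 + R \<le> w \<and>
        real_of_int w \<le> 1 + R + 2 * (real_of_int Y / real_of_int j')}"
    using pos by (intro pinecone_upper_row_eq) (auto simp: Y_def)
  have sign: "real_of_int (x - i) \<le> 0"
    using \<open>x \<le> i\<close> by simp
  have "strip_positions r s t i j k x =
    {w. 0 \<le> Y \<and> (\<exists>C. w = R + 1 + 2 * ((Y - i' * C) div j')) \<and> 1 + R \<le> w \<and>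
        real_of_int w \<le> 1 + R + 2 * (real_of_int Y / real_of_int j')}"
  proof (cases "0 \<le> Y")
    case True
    then show ?thesis
      unfolding strip_positions_def Let_def M c(3,4) sum wmax wmin range ex
      using sign by auto
  next
    case False
    \<comment> \<open>When the first range condition fails, the second clause must be excluded too.
      It could only apply at \<open>x = i\<close>, where \<open>Y = M \<ge> 0\<close>.\<close>
    then have "R \<noteq> 0" using \<open>0 \<le> M\<close> by (auto simp: Y_def)
    then have "\<not> 0 \<le> real_of_int (x - i)" using R by simp
    with False show ?thesis
      unfolding strip_positions_def Let_def M c(3,4) range by auto
  qed
  with row show ?thesis by (simp add: R_def)
qed

text \<open>Same argument with \<open>l'\<close> in place of \<open>k'\<close>. The strict
  \<open>i < x\<close> selects the second clause of \<open>strip_positions\<close>; the shared row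
  \<open>x = i\<close> belongs to the upper case.\<close>

lemma strip_positions_eq_lower_row:
  fixes c :: int
  assumes c: "0 < c" "t + s = c * i'" "t - s = c * j'" "t + r = c * k'" "t - r = c * l'"
    and M: "slanted_level r s t i j k = c * M" and even: "even (i + j + k)"
    and pos: "0 < j'" "j' \<le> i'" "0 < l'" and "i < x"
  shows "strip_positions r s t i j k x = pinecone_lower_row (M + i' + j') i' j' k' l' (x - i)"
proof -
  define R where "R = x - i"
  define Y where "Y = M - l' * R"
  have "c * (k' + l') = c * (i' + j')"
    using c by (simp add: algebra_simps)
  then have k': "k' = i' + j' - l'"
    using c(1) by simp
  have ex: "(\<exists>u. w = strip_w r s t j k x u) \<longleftrightarrow>
      (\<exists>C. w = R + 1 + 2 * ((Y - i' * C) div j'))" for w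
  proof -
    have w: "strip_w r s t j k x u =
        R + 1 + 2 * ((Y - i' * ((i + j + k) div 2 - u)) div j')" for u
    proof -
      \<comment> \<open>Replacing \<open>k'\<close> by \<open>i' + j' - l'\<close> absorbs the shift
        of the index, so that now \<open>C = (i + j + k) / 2 - u\<close>. The multiple
        \<open>R * j'\<close> raises the offset from \<open>- R + 1\<close> to
        \<open>R + 1\<close>.\<close>
      have "M - k' * (i - x) - i' * ((i + j + k) div 2 - u - (i - x)) =
          Y - i' * ((i + j + k) div 2 - u) + R * j'"
        unfolding R_def Y_def k' by (simp add: algebra_simps)
      then show ?thesis
        using strip_w_scaled[OF c(1-4) M even pos(1), of x u] pos(1) by (simp add: R_def)
    qed
    have "\<exists>u. C = (i + j + k) div 2 - u" for C
      by (rule exI[of _ "(i + j + k) div 2 - C"]) simp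
    then show ?thesis unfolding w by metis
  qed
  have "real_of_int (x - i) \<le> real_of_int (c * M) / real_of_int (c * l') \<longleftrightarrow>
      real_of_int R \<le> real_of_int M / real_of_int l'"
    using c(1) by (simp add: R_def)
  also have "\<dots> \<longleftrightarrow> real_of_int (l' * R) \<le> real_of_int M"
    using pos by (simp add: pos_le_divide_eq mult.commute)
  also have "\<dots> \<longleftrightarrow> 0 \<le> Y"
    unfolding of_int_le_iff Y_def by simp
  finally have range: "real_of_int (x - i) \<le> real_of_int (c * M) / real_of_int (c * l') \<longleftrightarrow> 0 \<le> Y" .
  have sum: "2 * r - t - s = c * (j' - 2 * l')"
    using c by (simp add: algebra_simps)
  have "2 * real_of_int (c * M) + real_of_int (c * (j' - 2 * l')) * real_of_int (x - i) =
      real_of_int c * (2 * real_of_int Y + R * real_of_int j')"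
    by (simp add: R_def Y_def algebra_simps)
  then have wmax: "1 + (2 * real_of_int (c * M) + real_of_int (c * (j' - 2 * l')) * real_of_int (x - i))
      / real_of_int (c * j') = 1 + R + 2 * (real_of_int Y / real_of_int j')"
    using c(1) pos by (simp add: field_simps)
  have wmin: "1 + real_of_int (x - i) \<le> real_of_int w \<longleftrightarrow> 1 + R \<le> w" for w
    by (simp add: R_def) linarith
  have row: "pinecone_lower_row (M + i' + j') i' j' k' l' R =
    {w. 0 \<le> Y \<and> (\<exists>C. w = R + 1 + 2 * ((Y - i' * C) div j')) \<and> 1 + R \<le> w \<and>
        real_of_int w \<le> 1 + R + 2 * (real_of_int Y / real_of_int j')}"
    unfolding pinecone_lower_row_eq_upper_row
    using pos by (intro pinecone_upper_row_eq) (auto simp: Y_def)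
  have sign: "\<not> real_of_int (x - i) \<le> 0" "0 \<le> real_of_int (x - i)"
    using \<open>i < x\<close> by simp_all
  show ?thesis
    unfolding R_def[symmetric] row
    unfolding strip_positions_def Let_def M c(3,5) sum wmax wmin range ex
    using sign by auto
qed

section \<open>Common scaling of the two parity cases, and assembly of the rows\<close>

theorem theorem2p7:
  fixes r s t i j k i' j' k' l' m' n' :: int
  assumes "0 \<le> r" and "r \<le> s" and "s < t"
    and "gcd r (gcd s t) = 1"
    and "even (i + j + k)"
    and "slanted_level r s t i j k \<ge> 0"
    and "(i', j', k', l', m', n') =
      (if odd r \<and> odd s \<and> odd t then
         ((t + s) div 2, (t - s) div 2, (t + r) div 2, (t - r) div 2, t,
          slanted_level r s t i j k div 2 + t)
       else
         (t + s, t - s, t + r, t - r, 2 * t, slanted_level r s t i j k + 2 * t))"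
  shows "pinecone_parameters i' j' k' l' m' \<and>
    (\<forall>x::int.
       (x \<ge> i \<longrightarrow>
          strip_positions r s t i j k x = pinecone_lower_row n' i' j' k' l' (x - i)) \<and>
       (x \<le> i \<longrightarrow>
          strip_positions r s t i j k x = pinecone_upper_row n' i' j' k' l' (i - x)))"
proof -
  define N where "N = slanted_level r s t i j k"
  \<comment> \<open>For odd coefficients \<open>N\<close> has the parity of
    \<open>i + j + k\<close>, so halving it is exact.\<close>
  have "even N" if "odd r" "odd s" "odd t"
    using that \<open>even (i + j + k)\<close> by (simp add: N_def slanted_level_def)
  then obtain c where c: "0 < c" "t + s = c * i'" "t - s = c * j'" "t + r = c * k'" "t - r = c * l'"
      "2 * t = c * m'" "N + 2 * t = c * n'"
  proof (cases "odd r \<and> odd s \<and> odd t")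
    case True
    with assms(7) \<open>\<lbrakk>odd r; odd s; odd t\<rbrakk> \<Longrightarrow> even N\<close> show ?thesis
      by (intro that[of 2]) (simp_all add: N_def)
  next
    case False
    with assms(7) show ?thesis
      by (intro that[of 1]) (auto simp: N_def)
  qed
  define M where "M = n' - (i' + j')"
  have "c * (i' + j') = c * m'" "c * (k' + l') = c * m'"
    using c(2-6) unfolding distrib_left by linarith+
  then have m: "i' + j' = m'" "k' + l' = m'"
    using c(1) by simp_all
  have M: "N = c * M"
    using c(6,7) unfolding M_def m right_diff_distrib by linarith
  \<comment> \<open>Multiplied by \<open>c\<close>, these compare \<open>t - s\<close> with
    \<open>t + s\<close> and \<open>t \<plusminus> r\<close>, which
    \<open>0 \<le> r \<le> s < t\<close> settles.\<close>
  have "0 < c * i'" "0 < c * j'" "0 < c * k'" "0 < c * l'" "c * j' \<le> c * i'" "c * j' \<le> c * k'"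
      "c * j' \<le> c * l'" "0 \<le> c * M"
    using assms(1-3,6) unfolding c(2-5)[symmetric] M[symmetric] N_def by simp_all
  then have pos: "0 < i'" "0 < j'" "0 < k'" "0 < l'" "0 \<le> M" and le: "j' \<le> i'" "j' \<le> k'" "j' \<le> l'"
    using c(1) by (simp_all add: zero_less_mult_iff zero_le_mult_iff)
  have n': "n' = M + i' + j'" by (simp add: M_def)
  have upper: "strip_positions r s t i j k x = pinecone_upper_row n' i' j' k' l' (i - x)"
    if "x \<le> i" for x
    unfolding n' using strip_positions_eq_upper_row[OF c(1-4) M[unfolded N_def] assms(5)] pos le that
    by blast
  have lower: "strip_positions r s t i j k x = pinecone_lower_row n' i' j' k' l' (x - i)"
    if "i \<le> x" for x
  \<comment> \<open>At \<open>R = 0\<close> the terms \<open>k * R\<close> and \<open>l * R\<close>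
    vanish, so lower and upper row coincide.\<close>
  proof (cases "x = i")
    case True
    then show ?thesis
      using upper[of x]
      by (simp add: pinecone_lower_row_def pinecone_upper_row_def pinecone_L_def pinecone_U_def)
  next
    case False
    then show ?thesis
      unfolding n' using strip_positions_eq_lower_row[OF c(1-5) M[unfolded N_def] assms(5)] pos le that
      by simp
  qed
  have "pinecone_parameters i' j' k' l' m'"
    using pos le m by (auto simp: pinecone_parameters_def min_def)
  with upper lower show ?thesis by blast
qed

end
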